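(* Let $c\in\mathbb{C}$ and let $n\geq 1$ be an integer. Let $f(z)$ be a nonconstant entire function of finite order such that $\Delta_c^n f(z)\not\equiv 0$. If $f(z)$, $\Delta_c^n f(z)$ and $\Delta_c^{n+1} f(z)$ share $0$ CM, then $\Delta_c f(z)\equiv C f(z)$ for some nonzero constant $C$.
   Context: Difference operators: for a meromorphic function $f$ in $\mathbb{C}$, $\Delta_c f(z)=f(z+c)-f(z)$ and $\Delta_c^n f(z)=\Delta_c^{n-1}(\Delta_c f(z))$ for $n\geq 2$. Finite order means $\rho(f)=\limsup_{r\to\infty}\frac{\log^+ T(r,f)}{\log r}<\infty$, where $T(r,f)$ is the Nevanlinna characteristic. Functions share $0$ CM if they all have the same zeros, counting multiplicities. *)

theory Defs
  imports "HOL-Complex_Analysis.Complex_Analysis"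
begin

definition log_plus :: "real \<Rightarrow> real" where
  "log_plus x = ln (max 1 x)"

text \<open>Meromorphic functions are total functions on the complex numbers; poles are detected by
  \<^const>\<open>is_pole\<close>, and the pole order is the negative of \<^const>\<open>zorder\<close>. The value that the
  function happens to take at a pole plays no role in the definitions below.\<close>

definition pole_count :: "(complex \<Rightarrow> complex) \<Rightarrow> real \<Rightarrow> nat" where
  "pole_count f t = (\<Sum>z | cmod z \<le> t \<and> is_pole f z. nat (- zorder f z))"

definition nevanlinna_m :: "real \<Rightarrow> (complex \<Rightarrow> complex) \<Rightarrow> real" where
  "nevanlinna_m r f =
     1 / (2 * pi) * integral {0..2 * pi} (\<lambda>\<theta>. log_plus (cmod (f (of_real r * cis \<theta>))))"

definition nevanlinna_N :: "real \<Rightarrow> (complex \<Rightarrow> complex) \<Rightarrow> real" where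
  "nevanlinna_N r f =
     integral {0..r} (\<lambda>t. (real (pole_count f t) - real (pole_count f 0)) / t)
       + real (pole_count f 0) * ln r"

definition nevanlinna_T :: "real \<Rightarrow> (complex \<Rightarrow> complex) \<Rightarrow> real" where
  "nevanlinna_T r f = nevanlinna_m r f + nevanlinna_N r f"

definition growth_order :: "(complex \<Rightarrow> complex) \<Rightarrow> ereal" where
  "growth_order f = Limsup at_top (\<lambda>r. ereal (log_plus (nevanlinna_T r f) / ln r))"

definition finite_order :: "(complex \<Rightarrow> complex) \<Rightarrow> bool" where
  "finite_order f \<longleftrightarrow> growth_order f < \<infinity>"

text \<open>The iterated operator $\Delta_c^n$ is \<open>difference c ^^ n\<close>.\<close>

definition difference :: "complex \<Rightarrow> (complex \<Rightarrow> complex) \<Rightarrow> complex \<Rightarrow> complex" where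
  "difference c f z = f (z + c) - f z"

text \<open>Intended for entire functions. At a zero of an entire function that is not identically
  zero, \<^const>\<open>zorder\<close> is the multiplicity. An identically zero function vanishes everywhere, so
  the first conjunct makes it share 0 only with itself.\<close>

definition share_zero_CM :: "(complex \<Rightarrow> complex) set \<Rightarrow> bool" where
  "share_zero_CM F \<longleftrightarrow>
     (\<forall>g\<in>F. \<forall>h\<in>F. \<forall>z. (g z = 0 \<longleftrightarrow> h z = 0) \<and> (g z = 0 \<longrightarrow> zorder g z = zorder h z))"

end

theory Submission
  imports Defs
begin

text \<open>
  Let $g = \Delta_c^n f$. An entire function of finite order is bounded by $\exp(C(1+|z|)^N)$, so the
  zero-free quotients $g/f$ and $\Delta_c g/g$ are $e^p$ and $e^q$ with polynomials $p$ and $q$. From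
  $g(z+c) = (1+e^{q(z)})\,g(z)$ and $f = e^{-p}g$, dividing $\Delta_c^n f = g$ by $g$ gives an identity
  between exponentials of polynomials alone:
  $$\sum_{k\le n}(-1)^{n-k}{n\choose k}\,e^{-p(z+kc)}\prod_{j<k}\bigl(1+e^{q(z+jc)}\bigr) = 1.$$
  Exponentials of polynomials that differ pairwise by more than constants are linearly independent.
  Comparing leading coefficients of the exponents yields $\deg p\le\deg q\le 1$, and if $q$ is linear,
  evaluating at a zero $z_0$ of $1+e^q$ and at $z_0-c$ shows that $e^q$ has period $c$. In that case $g$
  would be divisible by every power of $1+e^q$, which is absurd. So $p$ and $q$ are constant.
\<close>

section \<open>Growth of entire functions of finite order\<close>

text \<open>The pointwise bound replaces the characteristic because it passes to shifts and
  differences by elementary estimates. Once \<open>f\<close> and \<open>g\<close> are divided out,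
  only \<open>p\<close> and \<open>q\<close> are unknown. The obstacle is that exponents in the
  expanded identity may agree up to constants, so independence only says that each class of
  exponents modulo constants has coefficient sum 0, or 1 for the class of constants. The proof
  therefore seeks classes whose members are all known. Let d = deg q > 0 and let a be the leading
  coefficient of q. As deg p <= d, choosing e^q from the factors in S gives an exponent with d-th
  coefficient |S| a - p_d. The extreme |S| = n occurs once and forces p_d = n a. The other extreme,
  S empty, then gives nonconstant exponents, whose class sums must vanish.

  The identity alone cannot exclude linear q: by the binomial theorem it holds for p = n q whenever
  e^q has period c. Hence the return to the entire function \<open>g\<close> and the zeros of 1 +
  e^q in that case.\<close>

definition exp_poly_growth :: "(complex \<Rightarrow> complex) \<Rightarrow> bool" where
  "exp_poly_growth f \<longleftrightarrow> (\<exists>C\<ge>0. \<exists>N. \<forall>z. cmod (f z) \<le> exp (C * (1 + cmod z) ^ N))"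

lemma entire_finite_zeros:
  assumes "f holomorphic_on UNIV" "\<exists>z. f z \<noteq> 0"
  shows "finite {z \<in> cball 0 R. f z = 0}"
proof (cases "f constant_on UNIV")
  case True
  then have "{z \<in> cball 0 R. f z = 0} = {}"
    using assms(2) by (auto simp: constant_on_def)
  then show ?thesis
    by (metis finite.emptyI)
next
  case False
  then show ?thesis
    using holomorphic_compact_finite_zeros[OF assms(1), of "cball 0 R"] by auto
qed

text \<open>The local factor \<open>zor_poly f a\<close> fills the gap that the quotient by the
  power of \<open>z - a\<close> leaves at \<open>a\<close>. The case \<open>m = 0\<close> covers
  points where \<open>f\<close> does not vanish.\<close>

lemma entire_factor_zero:
  assumes "f holomorphic_on UNIV" "\<exists>z. f z \<noteq> 0"
  shows "\<exists>h m. h holomorphic_on UNIV \<and> h a \<noteq> 0 \<and> (\<forall>z. f z = (z - a) ^ m * h z)"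
proof -
  define m where "m = nat (zorder f a)"
  have nn: "\<exists>w\<in>UNIV. f w \<noteq> 0" using assms(2) by auto
  define k where "k = zor_poly f a"
  obtain r where r: "r > 0" and zp: "k holomorphic_on cball a r"
    and fac: "\<And>w. w \<in> cball a r \<Longrightarrow> f w = k w * (w - a) ^ m \<and> k w \<noteq> 0"
    using zorder_exist_zero[OF assms(1) open_UNIV connected_UNIV UNIV_I nn, of a]
    unfolding m_def[symmetric] k_def[symmetric] by blast
  define h where "h = (\<lambda>z. if z = a then k a else f z / (z - a) ^ m)"
  have heq: "h w = k w" if "w \<in> cball a r" for w
    using fac[OF that] by (auto simp: h_def)
  have hz: "f z = (z - a) ^ m * h z" for z
    using fac[of a] r by (auto simp: h_def)
  have "h holomorphic_on ball a r"
    using zp heq by (metis (no_types, lifting) ball_subset_cball holomorphic_cong holomorphic_on_subset subsetD)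
  moreover have "h holomorphic_on (UNIV - {a})"
  proof -
    have "(\<lambda>z. f z / (z - a) ^ m) holomorphic_on (UNIV - {a})"
      by (intro holomorphic_intros holomorphic_on_subset[OF assms(1)]) auto
    then show ?thesis
      by (rule holomorphic_transform) (auto simp: h_def)
  qed
  ultimately have "h holomorphic_on (ball a r \<union> (UNIV - {a}))"
    by (intro holomorphic_on_Un) auto
  moreover have "ball a r \<union> (UNIV - {a}) = UNIV"
    using r by auto
  ultimately have "h holomorphic_on UNIV" by metis
  moreover have "h a \<noteq> 0" using fac[of a] r by (auto simp: h_def)
  ultimately show ?thesis using hz by blast
qed

text \<open>The quotient of \<open>w - a\<close> by \<open>of_real R - cnj a * w / of_real R\<close>
  is the Blaschke factor of the disc of radius \<open>R\<close>. The identity \<open>id\<close>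
  shows at once that it is bounded by 1 inside and unimodular on the circle.\<close>

lemma blaschke_factor_norm:
  fixes a w :: complex and R :: real
  assumes "R > 0" "cmod a < R" "cmod w \<le> R"
  shows "cmod (w - a) \<le> cmod (of_real R - cnj a * w / of_real R)"
    and "cmod w = R \<Longrightarrow> cmod (w - a) = cmod (of_real R - cnj a * w / of_real R)"
    and "of_real R - cnj a * w / of_real R \<noteq> 0"
proof -
  have id: "(cmod (of_real R - cnj a * w / of_real R))\<^sup>2 - (cmod (w - a))\<^sup>2
      = (R\<^sup>2 - (cmod a)\<^sup>2) * (R\<^sup>2 - (cmod w)\<^sup>2) / R\<^sup>2"
    using assms(1) unfolding cmod_power2
    by (simp add: field_simps power2_eq_square)
  have "(cmod a)\<^sup>2 \<le> R\<^sup>2" "(cmod w)\<^sup>2 \<le> R\<^sup>2"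
    using assms by (auto intro!: power_mono)
  then have "(cmod (w - a))\<^sup>2 \<le> (cmod (of_real R - cnj a * w / of_real R))\<^sup>2"
    using id by (smt (verit, best) divide_nonneg_nonneg mult_nonneg_nonneg zero_le_power2)
  then show "cmod (w - a) \<le> cmod (of_real R - cnj a * w / of_real R)"
    by (rule power2_le_imp_le) simp
  show "cmod (w - a) = cmod (of_real R - cnj a * w / of_real R)" if "cmod w = R"
    using id that by (simp add: power2_eq_iff_nonneg)
  have "cmod (cnj a * w / of_real R) < R"
  proof -
    have "cmod (cnj a * w / of_real R) = cmod a * (cmod w / R)"
      using assms(1) by (simp add: norm_mult norm_divide)
    also have "\<dots> \<le> cmod a * 1"
      using assms by (intro mult_left_mono) auto
    finally show ?thesis using assms by simp
  qed
  then show "of_real R - cnj a * w / of_real R \<noteq> 0"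
    using assms(1) by auto
qed

text \<open>Each zero in the disc is exchanged for a Blaschke factor without zeros there.\<close>

lemma remove_zeros_in_disc:
  assumes "f holomorphic_on UNIV" "\<exists>z. f z \<noteq> 0" "R > 0"
  obtains F where "F holomorphic_on UNIV" "\<And>z. cmod z < R \<Longrightarrow> F z \<noteq> 0"
    "\<And>z. cmod z \<le> R \<Longrightarrow> cmod (f z) \<le> cmod (F z)" "\<And>z. cmod z = R \<Longrightarrow> cmod (F z) = cmod (f z)"
proof -
  have "\<exists>F. F holomorphic_on UNIV \<and> (\<forall>z. cmod z < R \<longrightarrow> F z \<noteq> 0) \<and>
      (\<forall>z. cmod z \<le> R \<longrightarrow> cmod (f z) \<le> cmod (F z)) \<and> (\<forall>z. cmod z = R \<longrightarrow> cmod (F z) = cmod (f z))"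
    using assms
  proof (induction "card {z \<in> ball 0 R. f z = 0}" arbitrary: f rule: less_induct)
    case (less f)
    have fin: "finite {z \<in> ball 0 R. f z = 0}"
      by (rule finite_subset[OF _ entire_finite_zeros[OF less.prems(1,2), of R]]) auto
    show ?case
    proof (cases "\<exists>a. cmod a < R \<and> f a = 0")
      case False
      then show ?thesis using less.prems by blast
    next
      case True
      then obtain a where a: "cmod a < R" "f a = 0" by blast
      obtain h m where h: "h holomorphic_on UNIV" "h a \<noteq> 0" "\<And>z. f z = (z - a) ^ m * h z"
        using entire_factor_zero[OF less.prems(1,2), where a = a] by blast
      have "m \<noteq> 0" using h(2) h(3)[of a] a by (cases m) auto
      \<comment> \<open>The full power of \<open>z - a\<close> has been split off, so the number of
        distinct zeros drops whatever the multiplicity.\<close>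
      have "{z \<in> ball 0 R. h z = 0} \<subset> {z \<in> ball 0 R. f z = 0}"
        using a h(2) by (auto simp: h(3) \<open>m \<noteq> 0\<close>)
      then have "card {z \<in> ball 0 R. h z = 0} < card {z \<in> ball 0 R. f z = 0}"
        by (rule psubset_card_mono[OF fin])
      from less.hyps[OF this h(1) _ less.prems(3)] h(2) obtain H where
        H: "H holomorphic_on UNIV" "\<And>z. cmod z < R \<Longrightarrow> H z \<noteq> 0"
        "\<And>z. cmod z \<le> R \<Longrightarrow> cmod (h z) \<le> cmod (H z)" "\<And>z. cmod z = R \<Longrightarrow> cmod (H z) = cmod (h z)"
        by blast
      define F where "F = (\<lambda>z. (of_real R - cnj a * z / of_real R) ^ m * H z)"
      have "F holomorphic_on UNIV"
        unfolding F_def using \<open>R > 0\<close> by (intro holomorphic_intros H) auto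
      moreover have "F z \<noteq> 0" if "cmod z < R" for z
        using blaschke_factor_norm(3)[OF \<open>R > 0\<close> a(1), of z] H(2)[OF that] that
        by (simp add: F_def)
      moreover have "cmod (f z) \<le> cmod (F z)" if "cmod z \<le> R" for z
        unfolding h(3) F_def norm_mult norm_power
        by (intro mult_mono power_mono blaschke_factor_norm H) (use that a \<open>R > 0\<close> in auto)
      moreover have "cmod (F z) = cmod (f z)" if "cmod z = R" for z
        unfolding h(3) F_def norm_mult norm_power
        using blaschke_factor_norm(2)[OF \<open>R > 0\<close> a(1), of z] H(4)[OF that] that by simp
      ultimately show ?thesis by blast
    qed
  qed
  then show thesis using that by blast
qed

text \<open>Stated for a holomorphic \<open>G\<close>, so that real parts give the Poisson formula
  for the logarithm of the modulus of a zero-free function.\<close>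

lemma poisson_formula:
  assumes "G holomorphic_on ball 0 R" "continuous_on (cball 0 R) G" "cmod z < R"
  shows "((\<lambda>t. G (of_real R * cis t) * of_real ((R\<^sup>2 - (cmod z)\<^sup>2) / (cmod (of_real R * cis t - z))\<^sup>2))
            has_integral (2 * of_real pi * G z)) {0..2*pi}"
proof -
  have R: "R > 0" using assms(3) norm_ge_zero[of z] by linarith
  \<comment> \<open>Cauchy's formula for \<open>H\<close>, which agrees with \<open>G\<close> at \<open>z\<close>, turns the Cauchy kernel into the Poisson kernel.\<close>
  define H where "H = (\<lambda>u. G u * (of_real (R\<^sup>2 - (cmod z)\<^sup>2) / (of_real (R\<^sup>2) - cnj z * u)))"
  have ne: "of_real (R\<^sup>2) - cnj z * u \<noteq> 0" if "cmod u \<le> R" for u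
  proof
    assume "of_real (R\<^sup>2) - cnj z * u = 0"
    then have "cmod (cnj z * u) = R\<^sup>2"
      by (metis eq_iff_diff_eq_0 norm_of_real abs_power2)
    moreover have "cmod z * cmod u \<le> cmod z * R"
      using that by (intro mult_left_mono) auto
    moreover have "cmod z * R < R * R"
      using R assms(3) by simp
    ultimately show False
      by (simp add: norm_mult power2_eq_square)
  qed
  have "((\<lambda>u. H u / (u - z)) has_contour_integral (2 * of_real pi * \<i> * H z)) (circlepath 0 R)"
  proof (rule Cauchy_integral_circlepath)
    show "continuous_on (cball 0 R) H"
      unfolding H_def by (intro continuous_intros assms) (use ne in auto)
    show "H holomorphic_on ball 0 R"
      unfolding H_def by (intro holomorphic_intros assms) (use ne in auto)
  qed (use assms in auto)
  then have 1: "((\<lambda>t. H (of_real R * cis t) / (of_real R * cis t - z) * of_real R * \<i> * cis t)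
      has_integral (2 * of_real pi * \<i> * H z)) {0..2*pi}"
    unfolding circlepath_def by (subst (asm) has_contour_integral_part_circlepath_iff) auto
  have Hz: "H z = G z"
  proof -
    have e: "of_real (R\<^sup>2 - (cmod z)\<^sup>2) = of_real (R\<^sup>2) - cnj z * z"
      using complex_norm_square[of z] by (simp add: mult.commute)
    show ?thesis
      using ne[of z] assms(3) unfolding H_def e by simp
  qed
  have 2: "H (of_real R * cis t) / (of_real R * cis t - z) * of_real R * \<i> * cis t
      = \<i> * (G (of_real R * cis t) * of_real ((R\<^sup>2 - (cmod z)\<^sup>2) / (cmod (of_real R * cis t - z))\<^sup>2))" for t
  proof -
    define u where "u = of_real R * cis t"
    have u: "cmod u = R" using R by (simp add: u_def norm_mult)
    have "u \<noteq> z" using u assms(3) by auto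
    \<comment> \<open>On the circle \<open>R^2 = u * cnj u\<close>; the factor \<open>u\<close>
      cancels the one coming from du, and the remaining \<open>cnj (u - z)\<close> completes the
      squared modulus.\<close>
    have e: "of_real (R\<^sup>2) - cnj z * u = u * cnj (u - z)"
      using u complex_norm_square[of u] by (simp add: algebra_simps)
    have "u \<noteq> 0" using u R by auto
    have "H u / (u - z) * u = G u * (of_real (R\<^sup>2 - (cmod z)\<^sup>2) / ((u - z) * cnj (u - z)))"
    proof -
      have "x * (A / (u * w)) / v * u = x * (A / (v * w))" for x A v w :: complex
        using \<open>u \<noteq> 0\<close> by simp
      then show ?thesis
        unfolding H_def e .
    qed
    also have "\<dots> = G u * of_real ((R\<^sup>2 - (cmod z)\<^sup>2) / (cmod (u - z))\<^sup>2)"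
      by (simp only: complex_norm_square[symmetric] of_real_divide)
    finally have "\<i> * (H u / (u - z) * u) = \<i> * (G u * of_real ((R\<^sup>2 - (cmod z)\<^sup>2) / (cmod (u - z))\<^sup>2))"
      by (rule arg_cong)
    then show ?thesis unfolding u_def by (simp only: mult_ac)
  qed
  have *: "((\<lambda>t. \<i> * (G (of_real R * cis t) * of_real ((R\<^sup>2 - (cmod z)\<^sup>2) / (cmod (of_real R * cis t - z))\<^sup>2)))
      has_integral (2 * of_real pi * \<i> * G z)) {0..2*pi}"
    using 1 unfolding 2 Hz .
  show ?thesis
  proof -
    have "- \<i> * (\<i> * x) = x" for x
      by (simp flip: mult.assoc)
    moreover have "- \<i> * (2 * of_real pi * \<i> * G z) = 2 * of_real pi * G z"
      by simp
    ultimately show ?thesis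
      using has_integral_mult_right[OF *, of "-\<i>"] by (simp only:)
  qed
qed

section \<open>From the Nevanlinna characteristic to pointwise bounds\<close>

lemma log_plus_nonneg: "log_plus x \<ge> 0"
  by (simp add: log_plus_def)

lemma ln_le_log_plus: "x > 0 \<Longrightarrow> ln x \<le> log_plus x"
  by (simp add: log_plus_def)

text \<open>An inequality of Poisson-Jensen type. A circle free of zeros makes \<open>F\<close>
  zero-free on the closed disc, so it has a logarithm \<open>G\<close> there, with real part
  \<open>ln (cmod (f w))\<close> at each \<open>w\<close> on the circle. The Poisson kernel is at
  most (R + |z|) / (R - |z|) <= 3 for |z| <= R/2; passing to \<open>log_plus\<close> first makes the
  integrand nonnegative, so that this bound applies.\<close>

lemma ln_norm_le_proximity:
  assumes "f holomorphic_on UNIV" "\<And>z. cmod z = R \<Longrightarrow> f z \<noteq> 0" "R > 0" "cmod z \<le> R / 2" "f z \<noteq> 0"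
  shows "ln (cmod (f z)) \<le> 3 * nevanlinna_m R f"
proof -
  obtain F where F: "F holomorphic_on UNIV" "\<And>z. cmod z < R \<Longrightarrow> F z \<noteq> 0"
    "\<And>z. cmod z \<le> R \<Longrightarrow> cmod (f z) \<le> cmod (F z)" "\<And>z. cmod z = R \<Longrightarrow> cmod (F z) = cmod (f z)"
    using remove_zeros_in_disc[OF assms(1) _ assms(3)] assms(5) by blast
  have Fnz: "F z \<noteq> 0" if "z \<in> cball 0 R" for z
    using F(2)[of z] F(4)[of z] assms(2)[of z] that
    by (metis mem_cball_0 norm_eq_zero order_le_less)
  obtain G where G: "G holomorphic_on cball 0 R" "\<And>z. z \<in> cball 0 R \<Longrightarrow> F z = exp (G z)"
    using contractible_imp_holomorphic_log[OF holomorphic_on_subset[OF F(1)], of "cball 0 R"] Fnz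
      convex_imp_contractible[OF convex_cball] by (metis subset_UNIV)
  have zR: "cmod z < R" using assms by linarith
  define k where "k = (\<lambda>t. (R\<^sup>2 - (cmod z)\<^sup>2) / (cmod (of_real R * cis t - z))\<^sup>2)"
  define u where "u = (\<lambda>t. of_real R * cis t)"
  have u: "cmod (u t) = R" for t using assms(3) by (simp add: u_def norm_mult)
  have "((\<lambda>t. G (u t) * of_real (k t)) has_integral (2 * of_real pi * G z)) {0..2*pi}"
    unfolding k_def u_def
    by (rule poisson_formula) (use G zR in \<open>auto intro: holomorphic_on_subset holomorphic_on_imp_continuous_on\<close>)
  from has_integral_Re[OF this]
  have 1: "((\<lambda>t. Re (G (u t)) * k t) has_integral (2 * pi * Re (G z))) {0..2*pi}"
    by simp
  have contlp: "continuous_on {0..2*pi} (\<lambda>t. log_plus (cmod (f (u t))))"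
    unfolding log_plus_def u_def
    by (intro continuous_intros holomorphic_on_imp_continuous_on continuous_on_compose2[OF holomorphic_on_imp_continuous_on[OF assms(1)]]) auto
  then have 2: "((\<lambda>t. 3 * log_plus (cmod (f (u t)))) has_integral (3 * integral {0..2*pi} (\<lambda>t. log_plus (cmod (f (u t)))))) {0..2*pi}"
    by (intro has_integral_mult_right integrable_integral integrable_continuous_interval)
  have k: "0 \<le> k t" "k t \<le> 3" for t
  proof -
    have sq: "(cmod z)\<^sup>2 \<le> R\<^sup>2" using zR by (intro power_mono) auto
    then show "0 \<le> k t" by (simp add: k_def)
    have "R - cmod z \<le> cmod (u t - z)" using norm_triangle_ineq2[of "u t" z] u[of t] by simp
    then have "(R - cmod z)\<^sup>2 \<le> (cmod (u t - z))\<^sup>2" using zR by (intro power_mono) auto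
    then have "k t \<le> (R\<^sup>2 - (cmod z)\<^sup>2) / (R - cmod z)\<^sup>2"
      unfolding k_def u_def[symmetric] using sq zR by (intro divide_left_mono) (auto simp: u_def intro!: mult_pos_pos)
    also have "\<dots> = (R + cmod z) / (R - cmod z)"
      using zR unfolding power2_eq_square square_diff_square_factored by simp
    also have "\<dots> \<le> 3"
      using zR assms(4) by (simp add: field_simps)
    finally show "k t \<le> 3" .
  qed
  have "2 * pi * Re (G z) \<le> 3 * integral {0..2*pi} (\<lambda>t. log_plus (cmod (f (u t))))"
  proof (rule has_integral_le[OF 1 2])
    fix t
    have "exp (Re (G (u t))) = cmod (f (u t))"
      using G(2)[of "u t"] F(4)[of "u t"] u[of t] by (simp add: norm_exp_eq_Re)
    then have "Re (G (u t)) = ln (cmod (f (u t)))"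
      by (metis ln_exp)
    also have "\<dots> \<le> log_plus (cmod (f (u t)))"
      using assms(2)[of "u t"] u by (intro ln_le_log_plus) auto
    finally have "Re (G (u t)) * k t \<le> log_plus (cmod (f (u t))) * k t"
      using k by (intro mult_right_mono)
    also have "\<dots> \<le> log_plus (cmod (f (u t))) * 3"
      using k log_plus_nonneg by (intro mult_left_mono)
    finally show "Re (G (u t)) * k t \<le> 3 * log_plus (cmod (f (u t)))" by simp
  qed
  then have "Re (G z) \<le> 3 * nevanlinna_m R f"
    unfolding nevanlinna_m_def u_def by (simp add: field_simps)
  moreover have "cmod (F z) = exp (Re (G z))"
    using G(2)[of z] zR by (simp add: norm_exp_eq_Re)
  then have "ln (cmod (f z)) \<le> Re (G z)"
    using F(3)[of z] zR assms(5) by (metis exp_gt_zero less_imp_le ln_exp ln_mono zero_less_norm_iff)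
  ultimately show ?thesis by linarith
qed

lemma nevanlinna_T_entire:
  assumes "f holomorphic_on UNIV"
  shows "nevanlinna_T r f = nevanlinna_m r f"
proof -
  have "\<not> is_pole f z" for z
    using not_is_pole_holomorphic[OF open_UNIV _ assms] by blast
  then show ?thesis
    by (simp add: nevanlinna_T_def nevanlinna_N_def pole_count_def)
qed

lemma nevanlinna_T_le_power:
  assumes "finite_order f"
  shows "\<exists>r0\<ge>1. \<exists>N. \<forall>r\<ge>r0. nevanlinna_T r f \<le> r ^ N"
proof -
  have "growth_order f \<noteq> \<infinity>" using assms by (simp add: finite_order_def)
  then obtain N where N: "growth_order f < ereal (real N)"
    using less_PInf_Ex_of_nat by (metis)
  have "eventually (\<lambda>r. ereal (log_plus (nevanlinna_T r f) / ln r) < ereal (real N)) at_top"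
    using N unfolding growth_order_def by (rule Limsup_lessD)
  then obtain r1 where r1: "\<And>r. r \<ge> r1 \<Longrightarrow> log_plus (nevanlinna_T r f) / ln r < real N"
    unfolding eventually_at_top_linorder by auto
  \<comment> \<open>The lower bound 2 keeps \<open>ln r\<close> positive, so the denominator can be
    cleared.\<close>
  have "\<forall>r\<ge>max r1 2. nevanlinna_T r f \<le> r ^ N"
  proof (intro allI impI)
    fix r :: real assume r: "r \<ge> max r1 2"
    then have "ln r > 0" by (intro ln_gt_zero) auto
    then have "log_plus (nevanlinna_T r f) \<le> real N * ln r"
      using r1[of r] r by (simp add: field_simps)
    then have "exp (log_plus (nevanlinna_T r f)) \<le> exp (real N * ln r)" by simp
    also have "\<dots> = r ^ N" using r by (simp add: exp_of_nat_mult)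
    finally show "nevanlinna_T r f \<le> r ^ N" by (simp add: log_plus_def)
  qed
  moreover have "max r1 2 \<ge> 1" by simp
  ultimately show ?thesis by blast
qed

lemma finite_order_imp_exp_poly_growth:
  assumes "f holomorphic_on UNIV" "finite_order f"
  shows "exp_poly_growth f"
proof (cases "\<exists>z. f z \<noteq> 0")
  case False
  then show ?thesis by (auto simp: exp_poly_growth_def intro!: exI[of _ 0])
next
  case True
  obtain r0 N where r0: "r0 \<ge> 1" "\<And>r. r \<ge> r0 \<Longrightarrow> nevanlinna_T r f \<le> r ^ N"
    using nevanlinna_T_le_power[OF assms(2)] by metis
  have "cmod (f z) \<le> exp (3 * (3 * r0) ^ N * (1 + cmod z) ^ N)" for z
  proof (cases "f z = 0")
    case False
    define r where "r = r0 * (1 + cmod z)"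
    have "r0 * cmod z \<ge> 1 * cmod z" using r0(1) by (intro mult_right_mono) auto
    then have r: "r \<ge> r0" "r \<ge> cmod z" using r0(1) by (auto simp: r_def algebra_simps)
    \<comment> \<open>Only finitely many radii carry zeros, so some circle with \<open>R\<close>
      between \<open>2*r\<close> and \<open>3*r\<close> avoids them. The lower end gives |z| <= R/2,
      the upper one keeps \<open>R\<close> comparable to 1 + |z|.\<close>
    have "infinite ({2*r..3*r} - cmod ` {z \<in> cball 0 (3*r). f z = 0})"
      using r r0(1) by (intro Diff_infinite_finite finite_imageI entire_finite_zeros assms True) auto
    then obtain R where R: "R \<in> {2*r..3*r} - cmod ` {z \<in> cball 0 (3*r). f z = 0}"
      by (metis ex_in_conv finite.emptyI)
    have "ln (cmod (f z)) \<le> 3 * nevanlinna_m R f"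
      by (rule ln_norm_le_proximity) (use R r r0(1) assms False in auto)
    also have "\<dots> \<le> 3 * R ^ N"
      using r0(2)[of R] R r r0(1) nevanlinna_T_entire[OF assms(1)] by simp
    also have "\<dots> \<le> 3 * (3 * r) ^ N"
      using R r r0(1) by (intro mult_left_mono power_mono) auto
    also have "\<dots> = 3 * (3 * r0) ^ N * (1 + cmod z) ^ N"
      by (simp add: r_def power_mult_distrib)
    finally show ?thesis
      using False by (metis exp_le_cancel_iff exp_ln zero_less_norm_iff)
  qed simp
  then show ?thesis
    unfolding exp_poly_growth_def using r0(1) by (intro exI[of _ "3 * (3 * r0) ^ N"]) auto
qed

section \<open>Stability of the growth bound under shifts and differences\<close>

lemma exp_poly_growth_shift:
  assumes "exp_poly_growth f"
  shows "exp_poly_growth (\<lambda>z. f (z + c))"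
proof -
  obtain C N where C: "C \<ge> 0" "\<And>z. cmod (f z) \<le> exp (C * (1 + cmod z) ^ N)"
    using assms by (auto simp: exp_poly_growth_def)
  have "cmod (f (z + c)) \<le> exp (C * (1 + cmod c) ^ N * (1 + cmod z) ^ N)" for z
  proof -
    have "1 + cmod (z + c) \<le> (1 + cmod c) * (1 + cmod z)"
    proof -
      have "(1 + cmod c) * (1 + cmod z) = 1 + cmod z + cmod c + cmod c * cmod z"
        by (simp add: algebra_simps)
      moreover have "cmod c * cmod z \<ge> 0"
        by simp
      ultimately show ?thesis
        using norm_triangle_ineq[of z c] by linarith
    qed
    then have "(1 + cmod (z + c)) ^ N \<le> ((1 + cmod c) * (1 + cmod z)) ^ N"
      by (intro power_mono) auto
    then have "C * (1 + cmod (z + c)) ^ N \<le> C * ((1 + cmod c) * (1 + cmod z)) ^ N"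
      using C(1) by (rule mult_left_mono)
    then show ?thesis
      using C(2)[of "z + c"] by (smt (verit) exp_le_cancel_iff mult.assoc power_mult_distrib)
  qed
  then show ?thesis
    unfolding exp_poly_growth_def using C(1) by (intro exI[of _ "C * (1 + cmod c) ^ N"]) auto
qed

lemma exp_poly_growth_diff:
  assumes "exp_poly_growth f" "exp_poly_growth g"
  shows "exp_poly_growth (\<lambda>z. f z - g z)"
proof -
  obtain C N where C: "C \<ge> 0" "\<And>z. cmod (f z) \<le> exp (C * (1 + cmod z) ^ N)"
    using assms by (auto simp: exp_poly_growth_def)
  obtain D M where D: "D \<ge> 0" "\<And>z. cmod (g z) \<le> exp (D * (1 + cmod z) ^ M)"
    using assms by (auto simp: exp_poly_growth_def)
  \<comment> \<open>The summand 1 in the constant pays for the factor 2 <= e in exp a + exp b <= 2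
    exp (a + b).\<close>
  have "cmod (f z - g z) \<le> exp ((1 + C + D) * (1 + cmod z) ^ (N + M))" for z
  proof -
    define x where "x = 1 + cmod z"
    have x: "x \<ge> 1" by (simp add: x_def)
    have "C * x ^ N \<le> C * x ^ (N + M)" "D * x ^ M \<le> D * x ^ (N + M)" "x ^ (N + M) \<ge> 1"
      using C D x by (auto intro!: mult_left_mono power_increasing)
    moreover have "0 \<le> C * x ^ N" "0 \<le> D * x ^ M" using C D x by auto
    moreover have "exp a + exp b \<le> exp (1 + a + b)" if "a \<ge> 0" "b \<ge> 0" for a b :: real
    proof -
      have "exp a + exp b \<le> 2 * exp (a + b)"
        using that by (smt (verit) exp_le_cancel_iff)
      also have "\<dots> \<le> exp 1 * exp (a + b)"
        using exp_ge_add_one_self[of 1] by (intro mult_right_mono) auto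
      finally show ?thesis by (simp add: exp_add mult.assoc)
    qed
    ultimately have "exp (C * x ^ N) + exp (D * x ^ M) \<le> exp (x ^ (N + M) + C * x ^ (N + M) + D * x ^ (N + M))"
      by (smt (verit) exp_le_cancel_iff)
    also have "\<dots> = exp ((1 + C + D) * x ^ (N + M))"
      by (simp add: algebra_simps)
    finally show ?thesis
      using C(2)[of z] D(2)[of z] norm_triangle_ineq4[of "f z" "g z"] unfolding x_def by linarith
  qed
  then show ?thesis
    unfolding exp_poly_growth_def using C(1) D(1) by (intro exI[of _ "1 + C + D"]) auto
qed

section \<open>Zero-free quotients\<close>

text \<open>The bound 2 r A / (R - r) of Borel and Caratheodory at r = R/2, which follows from the
  Schwarz lemma.\<close>

lemma borel_caratheodory:
  assumes "G holomorphic_on ball 0 R" "G 0 = 0" "\<And>z. cmod z < R \<Longrightarrow> Re (G z) < A"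
    and "R > 0" "cmod z \<le> R / 2"
  shows "cmod (G z) \<le> 2 * A"
proof -
  have A: "A > 0" using assms(2) assms(3)[of 0] assms(4) by simp
  \<comment> \<open>The Moebius map \<open>u / (2 A - u)\<close> sends the half plane \<open>Re u < A\<close> into the unit disc.\<close>
  define \<phi> where "\<phi> = (\<lambda>w. G (of_real R * w) / (of_real (2 * A) - G (of_real R * w)))"
  have in_ball: "cmod (of_real R * w) < R" if "cmod w < 1" for w
    using that assms(4) by (simp add: norm_mult)
  have ne: "of_real (2 * A) - G (of_real R * w) \<noteq> 0" if "cmod w < 1" for w
  proof -
    have "Re (of_real (2 * A) - G (of_real R * w)) > 0"
      using assms(3)[OF in_ball[OF that]] A by simp
    then show ?thesis by (metis less_irrefl zero_complex.sel(1))
  qed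
  have lt: "cmod (G (of_real R * w)) < cmod (of_real (2 * A) - G (of_real R * w))" if "cmod w < 1" for w
  proof -
    define u where "u = G (of_real R * w)"
    have "Re u < A" using assms(3)[OF in_ball[OF that]] by (simp add: u_def)
    have "(cmod (of_real (2 * A) - u))\<^sup>2 - (cmod u)\<^sup>2 = 4 * A * (A - Re u)"
      unfolding cmod_power2 by (simp add: power2_eq_square algebra_simps)
    moreover have "4 * A * (A - Re u) > 0"
      using A \<open>Re u < A\<close> by simp
    ultimately have "(cmod u)\<^sup>2 < (cmod (of_real (2 * A) - u))\<^sup>2" by linarith
    then show ?thesis unfolding u_def[symmetric] by (rule power2_less_imp_less) simp
  qed
  have "cmod (\<phi> (z / of_real R)) \<le> cmod (z / of_real R)"
  proof (rule Schwarz_Lemma(1))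
    have "(\<lambda>w. G (of_real R * w)) holomorphic_on ball 0 1"
      by (rule holomorphic_on_compose_gen[unfolded o_def, OF _ assms(1)])
         (use in_ball in \<open>auto intro!: holomorphic_intros\<close>)
    then show "\<phi> holomorphic_on ball 0 1"
      unfolding \<phi>_def by (intro holomorphic_intros) (use ne in auto)
    show "\<phi> 0 = 0" using assms(2) by (simp add: \<phi>_def)
    show "cmod (\<phi> w) < 1" if "cmod w < 1" for w
      using lt[OF that] ne[OF that] by (simp add: \<phi>_def norm_divide)
    show "cmod (z / of_real R) < 1"
      using assms(4,5) by (simp add: norm_divide)
  qed
  also have "\<dots> \<le> 1 / 2"
    using assms(4,5) by (simp add: norm_divide)
  finally have "cmod (G z / (of_real (2 * A) - G z)) \<le> 1 / 2"
    using assms(4) by (simp add: \<phi>_def)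
  moreover have "cmod (of_real (2 * A) - G z) > 0"
    using ne[of "z / of_real R"] assms(4,5) by (simp add: norm_divide)
  ultimately have "cmod (G z) \<le> cmod (of_real (2 * A) - G z) / 2"
    by (simp add: norm_divide field_simps)
  also have "cmod (of_real (2 * A) - G z) \<le> 2 * A + cmod (G z)"
    using norm_triangle_ineq4[of "of_real (2 * A)" "G z"] A by simp
  finally show ?thesis by simp
qed

text \<open>The maximum principle bounds the real part of \<open>G\<close> above by
  \<open>m\<close>, and Borel-Caratheodory turns this into a bound for the modulus; the summand 1
  supplies the strict inequality. The lower bound \<open>e\<close> is a separate parameter because
  \<open>F\<close> will vary with \<open>R\<close>, while \<open>e\<close> must not.\<close>

lemma norm_log_le:
  assumes "F holomorphic_on UNIV" "G holomorphic_on ball 0 R" "\<And>z. cmod z < R \<Longrightarrow> F z = exp (G z)"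
    and "\<And>z. cmod z = R \<Longrightarrow> cmod (F z) \<le> exp m" "0 < e" "e \<le> cmod (F 0)"
    and "R > 0" "cmod z \<le> R / 2"
  shows "cmod (G z - G 0) \<le> 2 * (m - ln e + 1)"
proof (rule borel_caratheodory[where G = "\<lambda>z. G z - G 0"])
  fix w assume w: "cmod w < R"
  have "cmod (F w) \<le> exp m"
    by (rule maximum_modulus_frontier[of F "ball 0 R"])
       (use assms w in \<open>auto intro: holomorphic_on_subset holomorphic_on_imp_continuous_on continuous_on_subset\<close>)
  then have "Re (G w) \<le> m"
    using assms(3)[OF w] by (simp add: norm_exp_eq_Re)
  moreover have "ln e \<le> ln (cmod (F 0))"
    using assms(5,6) by (intro ln_mono)
  then have "ln e \<le> Re (G 0)"
    using assms(3)[of 0] assms(7) by (simp add: norm_exp_eq_Re)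
  ultimately show "Re (G w - G 0) < m - ln e + 1" by simp
qed (use assms in \<open>auto intro!: holomorphic_intros\<close>)

text \<open>The zeros of \<open>f\<close> rule out an upper bound for 1/f, so \<open>P\<close> is
  written as \<open>(P + G) - G\<close> with \<open>G\<close> a logarithm of the zero-free
  substitute \<open>F\<close>. One \<open>F\<close> serves both functions, since
  \<open>g = exp P * f\<close> has the same zeros.\<close>

lemma exp_quotient_growth:
  assumes "f holomorphic_on UNIV" "P holomorphic_on UNIV" "\<And>z. g z = exp (P z) * f z"
    and "exp_poly_growth f" "exp_poly_growth g" "f 0 \<noteq> 0"
  shows "\<exists>B N. \<forall>z. cmod z \<ge> 1 \<longrightarrow> cmod (P z) \<le> B * cmod z ^ N"
proof -
  obtain C N where C: "C \<ge> 0" "\<And>z. cmod (f z) \<le> exp (C * (1 + cmod z) ^ N)"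
    using assms by (auto simp: exp_poly_growth_def)
  obtain D M where D: "D \<ge> 0" "\<And>z. cmod (g z) \<le> exp (D * (1 + cmod z) ^ M)"
    using assms by (auto simp: exp_poly_growth_def)
  have g0: "g 0 \<noteq> 0" using assms(3,6) by simp
  \<comment> \<open>The powers of 3 come from 1 + R = 1 + 2|z| <= 3|z| for |z| >= 1, and 4 collects
    the summand 1 of two applications of \<open>norm_log_le\<close>, each doubled.\<close>
  define K where "K = 4 + 2 * (C * 3 ^ N) + 2 * (D * 3 ^ M) + 2 * \<bar>ln (cmod (f 0))\<bar> + 2 * \<bar>ln (cmod (g 0))\<bar> + cmod (P 0)"
  have "cmod (P z) \<le> K * cmod z ^ (N + M)" if z: "cmod z \<ge> 1" for z
  proof -
    define R where "R = 2 * cmod z"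
    have R: "R > 0" "cmod z \<le> R / 2" using z by (auto simp: R_def)
    obtain F where F: "F holomorphic_on UNIV" "\<And>z. cmod z < R \<Longrightarrow> F z \<noteq> 0"
      "\<And>z. cmod z \<le> R \<Longrightarrow> cmod (f z) \<le> cmod (F z)" "\<And>z. cmod z = R \<Longrightarrow> cmod (F z) = cmod (f z)"
      using remove_zeros_in_disc[OF assms(1) _ R(1)] assms(6) by blast
    obtain G where G: "G holomorphic_on ball 0 R" "\<And>z. z \<in> ball 0 R \<Longrightarrow> F z = exp (G z)"
      using contractible_imp_holomorphic_log[OF holomorphic_on_subset[OF F(1)], of "ball 0 R"] F(2)
        convex_imp_contractible[OF convex_ball] by (metis mem_ball_0 subset_UNIV)
    \<comment> \<open>Both \<open>F\<close> and \<open>exp P * F\<close> are zero-free in the disc, with the moduli of \<open>f\<close> and \<open>g\<close> on the circle.\<close>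
    have 1: "cmod (G z - G 0) \<le> 2 * (C * (1 + R) ^ N - ln (cmod (f 0)) + 1)"
    proof (rule norm_log_le[OF F(1) G(1) _ _ _ _ R])
      show "cmod (F w) \<le> exp (C * (1 + R) ^ N)" if "cmod w = R" for w
        using F(4)[OF that] C(2)[of w] that by simp
      show "cmod (f 0) \<le> cmod (F 0)"
        using F(3)[of 0] R by simp
    qed (use G assms(6) in auto)
    have 2: "cmod ((P z + G z) - (P 0 + G 0)) \<le> 2 * (D * (1 + R) ^ M - ln (cmod (g 0)) + 1)"
    proof (rule norm_log_le[where F = "\<lambda>z. exp (P z) * F z" and G = "\<lambda>z. P z + G z", OF _ _ _ _ _ _ R])
      show "cmod (exp (P w) * F w) \<le> exp (D * (1 + R) ^ M)" if "cmod w = R" for w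
        using F(4)[OF that] D(2)[of w] that assms(3)[of w] by (simp add: norm_mult)
      show "cmod (g 0) \<le> cmod (exp (P 0) * F 0)"
        using F(3)[of 0] R assms(3)[of 0] by (simp add: norm_mult)
      show "(\<lambda>z. exp (P z) * F z) holomorphic_on UNIV" by (intro holomorphic_intros assms F)
      show "(\<lambda>z. P z + G z) holomorphic_on ball 0 R"
        using assms(2) G(1) by (intro holomorphic_intros) (auto intro: holomorphic_on_subset)
    qed (use G g0 in \<open>auto simp: exp_add\<close>)
    have "cmod (P z - P 0) \<le> cmod ((P z + G z) - (P 0 + G 0)) + cmod (G z - G 0)"
      using norm_triangle_ineq4[of "(P z + G z) - (P 0 + G 0)" "G z - G 0"] by (simp add: algebra_simps)
    moreover have "cmod (P z) \<le> cmod (P z - P 0) + cmod (P 0)"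
      using norm_triangle_ineq[of "P z - P 0" "P 0"] by simp
    ultimately have Pz: "cmod (P z) \<le> 2 * X + 2 * Y + W"
      if "X = C * (1 + R) ^ N" "Y = D * (1 + R) ^ M"
        "W = 4 + 2 * \<bar>ln (cmod (f 0))\<bar> + 2 * \<bar>ln (cmod (g 0))\<bar> + cmod (P 0)" for X Y W
      using 1 2 abs_ge_minus_self[of "ln (cmod (f 0))"] abs_ge_minus_self[of "ln (cmod (g 0))"]
      unfolding that(1,2)[symmetric] that(3) distrib_left right_diff_distrib by linarith
    have pow: "c * (1 + R) ^ k \<le> c * 3 ^ k * cmod z ^ (k + l)" if "c \<ge> 0" for c :: real and k l
    proof -
      have "(1 + R) ^ k \<le> (3 * cmod z) ^ k"
        using z by (intro power_mono) (auto simp: R_def)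
      also have "\<dots> \<le> 3 ^ k * cmod z ^ (k + l)"
        unfolding power_mult_distrib using z by (intro mult_left_mono power_increasing) auto
      finally show ?thesis using that by (simp add: mult.assoc mult_left_mono)
    qed
    define W where "W = 4 + 2 * \<bar>ln (cmod (f 0))\<bar> + 2 * \<bar>ln (cmod (g 0))\<bar> + cmod (P 0)"
    have "W \<ge> 0"
      unfolding W_def by (intro add_nonneg_nonneg) auto
    from mult_left_mono[OF one_le_power[OF z] this, of "N + M"]
    have "W \<le> W * cmod z ^ (N + M)" by simp
    with Pz[OF refl refl W_def] pow[OF C(1), of N M] pow[OF D(1), of M N]
    have "cmod (P z) \<le> 2 * (C * 3 ^ N * cmod z ^ (N + M)) + 2 * (D * 3 ^ M * cmod z ^ (N + M)) + W * cmod z ^ (N + M)"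
      by (simp add: add.commute[of M N])
    also have "\<dots> = K * cmod z ^ (N + M)"
      by (simp add: K_def W_def algebra_simps)
    finally show ?thesis .
  qed
  then show ?thesis by blast
qed

lemma exp_quotient_poly:
  assumes "f holomorphic_on UNIV" "h holomorphic_on UNIV" "\<And>z. h z \<noteq> 0" "\<And>z. g z = h z * f z"
    and "exp_poly_growth f" "exp_poly_growth g" "\<exists>z. f z \<noteq> 0"
  shows "\<exists>p. \<forall>z. h z = exp (poly p z)"
proof -
  obtain z0 where z0: "f z0 \<noteq> 0" using assms(7) by blast
  obtain P where P: "P holomorphic_on UNIV" "\<And>z. h z = exp (P z)"
    using contractible_imp_holomorphic_log[OF assms(2) contractible_UNIV] assms(3) by (metis UNIV_I)
  \<comment> \<open>Recentring at \<open>z0\<close> provides the nonzero value at the origin that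
    the growth estimate requires.\<close>
  define Q where "Q = (\<lambda>z. P (z + z0))"
  have shift: "(\<lambda>z. k (z + z0)) holomorphic_on UNIV" if "k holomorphic_on UNIV" for k
    by (rule holomorphic_on_compose_gen[unfolded o_def, OF _ that]) (auto intro!: holomorphic_intros)
  have Q: "Q holomorphic_on UNIV" unfolding Q_def by (rule shift[OF P(1)])
  have "\<exists>B N. \<forall>z. cmod z \<ge> 1 \<longrightarrow> cmod (Q z) \<le> B * cmod z ^ N"
    by (rule exp_quotient_growth[OF shift[OF assms(1)] Q _ exp_poly_growth_shift[OF assms(5)]
        exp_poly_growth_shift[OF assms(6)], of z0])
       (use z0 P(2) assms(4) in \<open>auto simp: Q_def\<close>)
  then obtain B N where B: "\<And>z. 1 \<le> cmod z \<Longrightarrow> cmod (Q z) \<le> B * cmod z ^ N" by blast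
  define q where "q = (\<Sum>k\<le>N. monom ((deriv^^k) Q 0 / fact k) k)"
  have "Q z = poly q z" for z
    using Liouville_polynomial[OF Q B] by (simp add: q_def poly_sum poly_monom)
  then have "P z = poly (pcompose q [:-z0, 1:]) z" for z
    unfolding poly_pcompose by (simp add: Q_def) (metis add.commute diff_add_cancel uminus_add_conv_diff)
  with P(2) show ?thesis by metis
qed

section \<open>Linear independence of exponentials of polynomials\<close>

text \<open>The left-hand side is the coefficient of e^R in the derivative of a e^R. For nonzero
  \<open>a\<close>, the product \<open>a * pderiv R\<close> has degree at least that of
  \<open>a\<close>, so \<open>pderiv a\<close> cannot cancel it.\<close>

lemma twisted_deriv_eq_0:
  fixes a R :: "complex poly"
  assumes "pderiv a + a * pderiv R = 0" "degree R > 0"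
  shows "a = 0"
proof (rule ccontr)
  assume "a \<noteq> 0"
  have "pderiv R \<noteq> 0" using assms(2) by (simp add: pderiv_eq_0_iff)
  then have "degree (a * pderiv R) \<ge> degree a" "a * pderiv R \<noteq> 0"
    using \<open>a \<noteq> 0\<close> by (auto simp: degree_mult_eq)
  moreover have "pderiv a = - (a * pderiv R)"
    using assms(1) by (simp add: eq_neg_iff_add_eq_0)
  ultimately have "pderiv a \<noteq> 0" "degree (pderiv a) \<ge> degree a" by auto
  then show False
    by (metis degree_pderiv diff_le_self diff_less le_antisym less_numeral_extra(1) linorder_not_le not_gr_zero pderiv_eq_0_iff)
qed

lemma has_field_derivative_poly_exp:
  "((\<lambda>z. poly a z * exp (poly R z)) has_field_derivative poly (pderiv a + a * pderiv R) z * exp (poly R z)) (at z)"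
  for a R :: "complex poly"
  by (auto intro!: derivative_eq_intros poly_DERIV simp: algebra_simps)

text \<open>Polynomial coefficients make the claim stable under differentiation, which multiplies
  even a constant coefficient by the derivative of its exponent.\<close>

lemma exp_poly_lin_indep:
  fixes a :: "complex poly \<Rightarrow> complex poly"
  assumes "finite A" "\<And>P Q. P \<in> A \<Longrightarrow> Q \<in> A \<Longrightarrow> P \<noteq> Q \<Longrightarrow> degree (P - Q) > 0"
    and "\<And>z. (\<Sum>P\<in>A. poly (a P) z * exp (poly P z)) = 0"
  shows "\<forall>P\<in>A. a P = 0"
  using assms
proof (induction A arbitrary: a rule: finite_induct)
  case empty
  then show ?case by simp
next
  case (insert P0 A)
  have deg: "degree (P - P0) > 0" if "P \<in> A" for P
    using insert.prems(1)[of P P0] insert.hyps that by blast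
  \<comment> \<open>Differentiating after division by \<open>exp P0\<close> eventually removes the term of \<open>P0\<close> without
    annihilating any other.\<close>
  have A_zero: "\<forall>P\<in>A. a P = 0"
    if "\<And>z. poly b z + (\<Sum>P\<in>A. poly (a P) z * exp (poly (P - P0) z)) = 0" "(pderiv ^^ k) b = 0" for b a k
    using that
  proof (induction k arbitrary: b a)
    case 0
    have "(\<Sum>P\<in>A. poly (a P) z * exp (poly P z)) = 0" for z
    proof -
      have "(\<Sum>P\<in>A. poly (a P) z * exp (poly P z)) = (\<Sum>P\<in>A. poly (a P) z * exp (poly (P - P0) z)) * exp (poly P0 z)"
        by (simp add: sum_distrib_right exp_diff mult.assoc)
      then show ?thesis using 0 by simp
    qed
    then show ?case using insert.IH insert.prems(1) by blast
  next
    case (Suc k)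
    define D where "D = (\<lambda>P. pderiv (a P) + a P * pderiv (P - P0))"
    have "poly (pderiv b) z + (\<Sum>P\<in>A. poly (D P) z * exp (poly (P - P0) z)) = 0" for z
    proof -
      have "((\<lambda>z. poly b z + (\<Sum>P\<in>A. poly (a P) z * exp (poly (P - P0) z))) has_field_derivative
          (poly (pderiv b) z + (\<Sum>P\<in>A. poly (D P) z * exp (poly (P - P0) z)))) (at z)"
        unfolding D_def by (intro DERIV_add poly_DERIV DERIV_sum has_field_derivative_poly_exp)
      moreover have "((\<lambda>z. poly b z + (\<Sum>P\<in>A. poly (a P) z * exp (poly (P - P0) z))) has_field_derivative 0) (at z)"
        unfolding Suc.prems(1) by simp
      ultimately show ?thesis by (rule DERIV_unique)
    qed
    then have "\<forall>P\<in>A. D P = 0"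
      using Suc.IH[of "pderiv b" D] Suc.prems(2) by (simp add: funpow_swap1)
    then show ?case
      using twisted_deriv_eq_0 deg unfolding D_def by blast
  qed
  have "(pderiv ^^ Suc (degree (a P0))) (a P0) = 0"
  proof -
    have "(pderiv ^^ Suc n) b = 0" if "degree b \<le> n" for n and b :: "complex poly"
      using that
    proof (induction n arbitrary: b)
      case 0
      then show ?case by (simp add: pderiv_eq_0_iff)
    next
      case (Suc n)
      then have "(pderiv ^^ Suc n) (pderiv b) = 0"
        by (intro Suc.IH) (simp add: degree_pderiv)
      then show ?case by (simp add: funpow_swap1)
    qed
    then show ?thesis by blast
  qed
  moreover have sum0: "poly (a P0) z + (\<Sum>P\<in>A. poly (a P) z * exp (poly (P - P0) z)) = 0" for z
  proof -
    have "exp (poly P0 z) * (poly (a P0) z + (\<Sum>P\<in>A. poly (a P) z * exp (poly (P - P0) z)))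
        = (\<Sum>P\<in>insert P0 A. poly (a P) z * exp (poly P z))"
      using insert.hyps by (simp add: distrib_left sum_distrib_left exp_diff field_simps)
    also have "\<dots> = 0" using insert.prems(2) .
    finally show ?thesis by simp
  qed
  ultimately have A0: "\<forall>P\<in>A. a P = 0" using A_zero by blast
  then have "poly (a P0) z = 0" for z using sum0[of z] by simp
  then have "a P0 = 0" using poly_all_0_iff_0 by blast
  with A0 show ?case by simp
qed

text \<open>Exponents are classified modulo constants, each class being represented by its member without
  constant term.\<close>

definition drop_const :: "complex poly \<Rightarrow> complex poly" where
  "drop_const P = P - [:coeff P 0:]"

lemma coeff_drop_const: "coeff (drop_const P) k = (if k = 0 then 0 else coeff P k)"
  by (simp add: drop_const_def coeff_pCons split: nat.split)

lemma degree_drop_const_diff: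
  assumes "drop_const P \<noteq> drop_const Q"
  shows "degree (drop_const P - drop_const Q) > 0"
proof (rule ccontr)
  assume "\<not> ?thesis"
  then obtain c where c: "drop_const P - drop_const Q = [:c:]"
    by (metis degree_eq_zeroE neq0_conv)
  have "c = coeff (drop_const P - drop_const Q) 0" by (simp add: c)
  also have "\<dots> = 0" by (simp add: coeff_drop_const)
  finally show False using c assms by simp
qed

text \<open>Within a class the exponentials differ by constant factors only, so each class collapses
  to one term and the class representatives are independent. The constant \<open>d\<close> belongs
  to the class of 0.\<close>

lemma exp_poly_class_sum:
  fixes b :: "'i \<Rightarrow> complex" and E :: "'i \<Rightarrow> complex poly"
  assumes "finite I" "\<And>z. (\<Sum>i\<in>I. b i * exp (poly (E i) z)) = d"
  shows "(\<Sum>i\<in>{i\<in>I. drop_const (E i) = Q}. b i * exp (coeff (E i) 0)) = (if Q = 0 then d else 0)"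
proof -
  define s where "s = (\<lambda>Q. \<Sum>i\<in>{i\<in>I. drop_const (E i) = Q}. b i * exp (coeff (E i) 0))"
  define t where "t = (\<lambda>Q. s Q - (if Q = 0 then d else 0))"
  \<comment> \<open>The class 0 is included even if no exponent lies in it: then its empty sum must
    still equal \<open>d\<close>.\<close>
  define A where "A = insert 0 ((\<lambda>i. drop_const (E i)) ` I)"
  have finA: "finite A" using assms(1) by (simp add: A_def)
  have A_drop: "drop_const Q = Q" if "Q \<in> A" for Q
    using that by (auto simp: A_def poly_eq_iff coeff_drop_const)
  have "\<forall>Q\<in>A. [:t Q:] = 0"
  proof (rule exp_poly_lin_indep[OF finA])
    fix P Q assume "P \<in> A" "Q \<in> A" "P \<noteq> Q"
    then show "degree (P - Q) > 0"
      using degree_drop_const_diff[of P Q] A_drop by simp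
  next
    fix z
    have "(\<Sum>Q\<in>A. s Q * exp (poly Q z))
        = (\<Sum>Q\<in>A. \<Sum>i\<in>{i\<in>I. drop_const (E i) = Q}. b i * exp (poly (E i) z))"
    proof (rule sum.cong[OF refl])
      fix Q
      have "exp (poly (E i) z) = exp (coeff (E i) 0) * exp (poly (drop_const (E i)) z)" for i
        by (simp add: drop_const_def flip: exp_add)
      then show "s Q * exp (poly Q z) = (\<Sum>i\<in>{i\<in>I. drop_const (E i) = Q}. b i * exp (poly (E i) z))"
        unfolding s_def sum_distrib_right by (intro sum.cong) auto
    qed
    also have "\<dots> = (\<Sum>i\<in>I. b i * exp (poly (E i) z))"
      by (rule sum.group) (use assms(1) finA in \<open>auto simp: A_def\<close>)
    also have "\<dots> = d" using assms(2) .
    finally have "(\<Sum>Q\<in>A. s Q * exp (poly Q z)) = d" .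
    moreover have "(\<Sum>Q\<in>A. (if Q = 0 then d else 0) * exp (poly Q z)) = d"
    proof -
      have "(\<Sum>Q\<in>A. (if Q = 0 then d else 0) * exp (poly Q z)) = (\<Sum>Q\<in>A. if Q = 0 then d else 0)"
        by (rule sum.cong) auto
      also have "\<dots> = d" using finA by (simp add: A_def)
      finally show ?thesis .
    qed
    ultimately show "(\<Sum>Q\<in>A. poly [:t Q:] z * exp (poly Q z)) = 0"
      by (simp add: t_def left_diff_distrib sum_subtractf)
  qed
  then have "t Q = 0" if "Q \<in> A" using that by simp
  moreover have "s Q = 0" "Q \<noteq> 0" if "Q \<notin> A"
    using that by (auto simp: A_def s_def intro!: sum.neutral)

  ultimately have "s Q = (if Q = 0 then d else 0)"
    by (cases "Q \<in> A") (auto simp: t_def)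
  then show ?thesis
    by (simp add: s_def)
qed

section \<open>The exponential identity\<close>

text \<open>Pascal's rule, as needed in the inductive step for iterated differences. The sign is
  written with \<open>n + k\<close>, which has the parity of \<open>n - k\<close> and avoids
  truncated subtraction.\<close>

lemma binomial_difference:
  fixes u :: "nat \<Rightarrow> complex"
  shows "(\<Sum>k\<le>n. (-1) ^ (n + k) * of_nat (n choose k) * (u (Suc k) - u k))
    = (\<Sum>k\<le>Suc n. (-1) ^ (Suc n + k) * of_nat (Suc n choose k) * u k)"
proof -
  have "(\<Sum>k\<le>Suc n. (-1) ^ (Suc n + k) * of_nat (Suc n choose k) * u k)
      = (-1) ^ Suc n * u 0 + (\<Sum>k\<le>n. (-1) ^ (n + k) * of_nat (Suc n choose Suc k) * u (Suc k))"
    by (subst sum.atMost_Suc_shift) simp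
  also have "(\<Sum>k\<le>n. (-1) ^ (n + k) * of_nat (Suc n choose Suc k) * u (Suc k))
      = (\<Sum>k\<le>n. (-1) ^ (n + k) * of_nat (n choose k) * u (Suc k))
        + (\<Sum>k\<le>n. (-1) ^ (n + k) * of_nat (n choose Suc k) * u (Suc k))"
    by (simp add: algebra_simps flip: sum.distrib)
  also have "(\<Sum>k\<le>n. (-1) ^ (n + k) * of_nat (n choose Suc k) * u (Suc k))
      = (\<Sum>k\<le>Suc n. (-1) ^ (Suc n + k) * of_nat (n choose k) * u k) - (-1) ^ Suc n * u 0"
    by (subst sum.atMost_Suc_shift) simp
  also have "(\<Sum>k\<le>Suc n. (-1) ^ (Suc n + k) * of_nat (n choose k) * u k)
      = - (\<Sum>k\<le>n. (-1) ^ (n + k) * of_nat (n choose k) * u k)"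
    by (simp add: sum_negf)
  finally show ?thesis
    by (simp add: right_diff_distrib sum_subtractf)
qed

lemma difference_funpow:
  "(difference c ^^ n) f z = (\<Sum>k\<le>n. (-1) ^ (n + k) * of_nat (n choose k) * f (z + of_nat k * c))"
proof (induction n arbitrary: z)
  case (Suc n)
  have "(difference c ^^ Suc n) f z = (difference c ^^ n) f (z + c) - (difference c ^^ n) f z"
    by (simp add: difference_def)
  also have "\<dots> = (\<Sum>k\<le>n. (-1) ^ (n + k) * of_nat (n choose k) * (f (z + of_nat (Suc k) * c) - f (z + of_nat k * c)))"
    unfolding Suc.IH by (simp add: right_diff_distrib sum_subtractf algebra_simps)
  finally show ?case
    by (simp only: binomial_difference[where u = "\<lambda>k. f (z + of_nat k * c)"])
qed simp

lemma holomorphic_difference: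
  assumes "f holomorphic_on UNIV"
  shows "difference c f holomorphic_on UNIV"
proof -
  have "(\<lambda>z. f (z + c)) holomorphic_on UNIV"
    by (rule holomorphic_on_compose_gen[unfolded o_def, OF _ assms]) (auto intro!: holomorphic_intros)
  then have "(\<lambda>z. f (z + c) - f z) holomorphic_on UNIV"
    using assms by (rule holomorphic_on_diff)
  then show ?thesis by (simp add: difference_def[abs_def])
qed

lemma holomorphic_difference_funpow:
  "f holomorphic_on UNIV \<Longrightarrow> (difference c ^^ n) f holomorphic_on UNIV"
  by (induction n) (auto intro: holomorphic_difference)

lemma exp_poly_growth_difference_funpow:
  assumes "exp_poly_growth f"
  shows "exp_poly_growth ((difference c ^^ n) f)"
proof (induction n)
  case (Suc n)
  then have "exp_poly_growth (\<lambda>z. (difference c ^^ n) f (z + c) - (difference c ^^ n) f z)"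
    by (intro exp_poly_growth_diff exp_poly_growth_shift)
  then show ?case by (simp add: difference_def[abs_def])
qed (use assms in simp)

section \<open>Shifted polynomials and their classes modulo constants\<close>

abbreviation shift_poly :: "complex poly \<Rightarrow> complex \<Rightarrow> complex poly" where
  "shift_poly p t \<equiv> pcompose p [:t, 1:]"

lemma poly_shift_poly: "poly (shift_poly p t) z = poly p (z + t)"
  by (simp add: poly_pcompose add.commute)

lemma degree_shift_poly: "degree (shift_poly p t) = degree p"
  by (simp add: degree_pcompose)

lemma coeff_shift_poly_top:
  assumes "degree p \<le> d"
  shows "coeff (shift_poly p t) d = coeff p d"
proof (cases "degree p = d")
  case True
  have "lead_coeff (shift_poly p t) = lead_coeff p"
    by (simp add: lead_coeff_comp)
  with True show ?thesis by (simp add: degree_shift_poly)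
next
  case False
  then show ?thesis using assms by (simp add: coeff_eq_0 degree_shift_poly)
qed

lemma drop_const_eq_iff: "drop_const P = drop_const Q \<longleftrightarrow> (\<forall>k>0. coeff P k = coeff Q k)"
  by (auto simp: poly_eq_iff coeff_drop_const)

text \<open>If two shifts differed by a constant, the derivative of \<open>p\<close> would have the
  nonzero period \<open>t - s\<close>, hence take its value at 0 infinitely often and be
  constant.\<close>

lemma shift_poly_class_inj:
  assumes "drop_const (shift_poly p s) = drop_const (shift_poly p t)" "degree p \<ge> 2"
  shows "s = t"
proof (rule ccontr)
  assume "s \<noteq> t"
  define r where "r = pderiv p"
  define \<tau> where "\<tau> = t - s"
  have "pderiv (shift_poly p s) = pderiv (shift_poly p t)"
    using assms(1) unfolding drop_const_eq_iff by (intro poly_eqI) (simp add: coeff_pderiv)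
  then have eq: "shift_poly r s = shift_poly r t"
    by (simp add: pderiv_pcompose r_def pderiv_pCons)
  have per: "poly r (z + \<tau>) = poly r z" for z
    using arg_cong[OF eq, of "\<lambda>p. poly p (z - s)"] unfolding poly_shift_poly
    by (simp add: \<tau>_def algebra_simps)
  have "poly (r - [:poly r 0:]) (of_nat k * \<tau>) = 0" for k
  proof (induction k)
    case (Suc k)
    then show ?case using per[of "of_nat k * \<tau>"] by (simp add: algebra_simps)
  qed simp
  then have "range (\<lambda>k. of_nat k * \<tau>) \<subseteq> {z. poly (r - [:poly r 0:]) z = 0}" by auto
  moreover have "inj (\<lambda>k. of_nat k * \<tau>)"
    using \<open>s \<noteq> t\<close> by (auto simp: inj_on_def \<tau>_def)
  ultimately have "infinite {z. poly (r - [:poly r 0:]) z = 0}"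
    using infinite_super range_inj_infinite by blast
  then have "r - [:poly r 0:] = 0"
    using poly_roots_finite by blast
  then have "degree r = 0"
    by (metis degree_pCons_0 eq_iff_diff_eq_0)
  then show False
    using assms(2) by (simp add: r_def degree_pderiv)
qed

text \<open>The quotient \<open>(difference c ^^ n) f / g\<close> for $f = e^{-p}g$ with $g(z+c) = (1+e^{q(z)})\,g(z)$.\<close>

definition exp_difference_sum :: "complex \<Rightarrow> nat \<Rightarrow> complex poly \<Rightarrow> complex poly \<Rightarrow> complex \<Rightarrow> complex" where
  "exp_difference_sum c n p q z = (\<Sum>k\<le>n. (-1) ^ (n + k) * of_nat (n choose k) * exp (- poly p (z + of_nat k * c))
      * (\<Prod>j<k. 1 + exp (poly q (z + of_nat j * c))))"

text \<open>The pair $(k, S)$ stands for the choice, in the $k$-th summand, of the term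
  $e^{q(z+jc)}$ from the factors with $j \in S$ and of $1$ from the others.\<close>

definition expansion_index :: "nat \<Rightarrow> (nat \<times> nat set) set" where
  "expansion_index n = (SIGMA k:{..n}. Pow {..<k})"

definition expansion_exponent :: "complex \<Rightarrow> complex poly \<Rightarrow> complex poly \<Rightarrow> nat \<times> nat set \<Rightarrow> complex poly" where
  "expansion_exponent c p q = (\<lambda>(k, S). (\<Sum>j\<in>S. shift_poly q (of_nat j * c)) - shift_poly p (of_nat k * c))"

lemma finite_expansion_index: "finite (expansion_index n)"
  unfolding expansion_index_def by (intro finite_SigmaI) (auto intro: finite_subset)

lemma exp_difference_sum_expand:
  "exp_difference_sum c n p q z = (\<Sum>i\<in>expansion_index n. (-1) ^ (n + fst i) * of_nat (n choose fst i)
      * exp (poly (expansion_exponent c p q i) z))"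
proof -
  have "(-1) ^ (n + k) * of_nat (n choose k) * exp (- poly p (z + of_nat k * c)) * (\<Prod>j<k. 1 + exp (poly q (z + of_nat j * c)))
      = (\<Sum>S\<in>Pow {..<k}. (-1) ^ (n + k) * of_nat (n choose k) * exp (poly (expansion_exponent c p q (k, S)) z))" for k
  proof -
    have "(\<Prod>j<k. 1 + exp (poly q (z + of_nat j * c))) = (\<Sum>S\<in>Pow {..<k}. \<Prod>j\<in>S. exp (poly q (z + of_nat j * c)))"
      by (subst add.commute, subst prod_add) auto
    also have "\<dots> = (\<Sum>S\<in>Pow {..<k}. exp (\<Sum>j\<in>S. poly q (z + of_nat j * c)))"
      by (intro sum.cong refl) (auto intro!: exp_sum[symmetric] intro: finite_subset)
    finally show ?thesis
      by (simp add: sum_distrib_left expansion_exponent_def poly_sum poly_shift_poly exp_diff exp_minus field_simps)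
  qed
  then have "exp_difference_sum c n p q z = (\<Sum>k\<le>n. \<Sum>S\<in>Pow {..<k}. (-1) ^ (n + k) * of_nat (n choose k)
      * exp (poly (expansion_exponent c p q (k, S)) z))"
    by (simp add: exp_difference_sum_def)
  also have "\<dots> = (\<Sum>(k, S)\<in>(SIGMA k:{..n}. Pow {..<k}). (-1) ^ (n + k) * of_nat (n choose k)
      * exp (poly (expansion_exponent c p q (k, S)) z))"
    by (rule sum.Sigma) auto
  finally show ?thesis
    by (simp add: expansion_index_def case_prod_unfold)
qed

text \<open>A shift does not change the coefficient in degree \<open>d\<close> of a polynomial of
  degree at most \<open>d\<close>. So this coefficient, which is an invariant of the class if
  \<open>d > 0\<close>, depends on the pair only through \<open>card S\<close>.\<close>

lemma coeff_expansion_exponent_top: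
  assumes "(k, S) \<in> expansion_index n" "degree p \<le> d" "degree q \<le> d"
  shows "coeff (expansion_exponent c p q (k, S)) d = of_nat (card S) * coeff q d - coeff p d"
  using assms by (simp add: expansion_exponent_def coeff_sum coeff_shift_poly_top)

section \<open>What the identity says about the degrees and coefficients of p and q\<close>

context
  fixes c :: complex and n :: nat and p q :: "complex poly"
  assumes exp_identity: "\<And>z. exp_difference_sum c n p q z = 1"
begin

lemma expansion_class_sum:
  "(\<Sum>i\<in>{i\<in>expansion_index n. drop_const (expansion_exponent c p q i) = Q}.
      (-1) ^ (n + fst i) * of_nat (n choose fst i) * exp (coeff (expansion_exponent c p q i) 0))
    = (if Q = 0 then 1 else 0)"
  using exp_poly_class_sum[OF finite_expansion_index exp_identity[unfolded exp_difference_sum_expand]] .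

text \<open>The class sum is a single term, a sign times the binomial coefficient 1 times an
  exponential. It is not 0, and only the class of constants has a nonzero sum.\<close>

lemma singleton_class_eq_0:
  assumes "{i\<in>expansion_index n. drop_const (expansion_exponent c p q i) = drop_const (expansion_exponent c p q (n, S))} = {(n, S)}"
  shows "drop_const (expansion_exponent c p q (n, S)) = 0"
  using expansion_class_sum[of "drop_const (expansion_exponent c p q (n, S))"] unfolding assms
  by (auto split: if_splits)

text \<open>The class of constants has sum 1 and so is inhabited, but for larger degree of
  \<open>p\<close> every exponent would retain the leading term of \<open>- p\<close>.\<close>

lemma degree_p_le_degree_q: "degree p \<le> degree q"
proof (rule ccontr)
  assume "\<not> ?thesis"
  then have d: "degree q < degree p" by simp
  have "{i\<in>expansion_index n. drop_const (expansion_exponent c p q i) = 0} \<noteq> {}"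
  proof
    assume "{i\<in>expansion_index n. drop_const (expansion_exponent c p q i) = 0} = {}"
    then show False using expansion_class_sum[of 0] by (simp only:) simp
  qed
  then obtain k S where i: "(k, S) \<in> expansion_index n" "drop_const (expansion_exponent c p q (k, S)) = 0"
    by auto
  have "coeff (expansion_exponent c p q (k, S)) (degree p) = 0"
    using i(2) d coeff_drop_const[of _ "degree p"] by (metis coeff_0 gr_implies_not0)
  moreover have "coeff (expansion_exponent c p q (k, S)) (degree p) = - lead_coeff p"
    using coeff_expansion_exponent_top[OF i(1), of p "degree p" q c] d by (simp add: coeff_eq_0)
  ultimately show False using d by simp
qed

lemma coeff_p_degree_q:
  assumes "degree q > 0"
  shows "coeff p (degree q) = of_nat n * lead_coeff q"
proof -
  let ?E = "expansion_exponent c p q"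
  \<comment> \<open>Only \<open>(n, {..<n})\<close> contains \<open>n\<close> copies of the leading term of \<open>q\<close>, so its class is the class of \<open>0\<close>.\<close>
  have top: "(n, {..<n}) \<in> expansion_index n" by (simp add: expansion_index_def)
  have "i = (n, {..<n})" if i: "i \<in> expansion_index n" "drop_const (?E i) = drop_const (?E (n, {..<n}))" for i
  proof -
    obtain k S where kS: "i = (k, S)" by (cases i)
    have "coeff (?E (k, S)) (degree q) = coeff (?E (n, {..<n})) (degree q)"
      using i(2) assms unfolding kS drop_const_eq_iff by blast
    then have "of_nat (card S) * lead_coeff q = of_nat n * lead_coeff q"
      using coeff_expansion_exponent_top[OF i(1)[unfolded kS] degree_p_le_degree_q order_refl, of c]
        coeff_expansion_exponent_top[OF top degree_p_le_degree_q order_refl, of c] by simp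
    then have "card S = n" using assms by auto
    moreover have "S \<subseteq> {..<k}" "k \<le> n" using i(1) by (auto simp: kS expansion_index_def)
    ultimately have "k = n"
      using card_mono[of "{..<k}" S] by simp
    moreover have "S = {..<k}"
      using \<open>card S = n\<close> \<open>k = n\<close> \<open>S \<subseteq> {..<k}\<close> by (intro card_subset_eq) auto
    ultimately show ?thesis by (simp add: kS)
  qed
  then have "{i\<in>expansion_index n. drop_const (?E i) = drop_const (?E (n, {..<n}))} = {(n, {..<n})}"
    using top by auto
  then have "drop_const (?E (n, {..<n})) = 0" by (rule singleton_class_eq_0)
  then have "coeff (?E (n, {..<n})) (degree q) = 0"
    using assms coeff_drop_const[of "?E (n, {..<n})" "degree q"] by simp
  then show ?thesis
    using coeff_expansion_exponent_top[OF top degree_p_le_degree_q order_refl, of c] by simp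
qed

text \<open>For degree at least 2, distinct shifts of \<open>p\<close> lie in distinct classes, so
  \<open>(n, {})\<close> would be alone in its class. Its exponent is nonconstant by
  \<open>coeff_p_degree_q\<close>, which contradicts \<open>singleton_class_eq_0\<close>.\<close>

lemma degree_q_le_1:
  assumes "c \<noteq> 0" "n \<ge> 1"
  shows "degree q \<le> 1"
proof (rule ccontr)
  assume "\<not> ?thesis"
  then have d: "degree q \<ge> 2" by simp
  let ?E = "expansion_exponent c p q"
  have lead: "coeff p (degree q) = of_nat n * lead_coeff q" using d by (intro coeff_p_degree_q) simp
  have "lead_coeff q \<noteq> 0" using d by auto
  then have lead0: "coeff p (degree q) \<noteq> 0" using assms(2) lead by simp
  then have dp: "degree p \<ge> 2" using d le_degree by (meson le_trans)
  have bot: "(n, {}) \<in> expansion_index n" by (simp add: expansion_index_def)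
  have "i = (n, {})" if i: "i \<in> expansion_index n" "drop_const (?E i) = drop_const (?E (n, {}))" for i
  proof -
    obtain k S where kS: "i = (k, S)" by (cases i)
    have "coeff (?E (k, S)) (degree q) = coeff (?E (n, {})) (degree q)"
      using i(2) d unfolding kS drop_const_eq_iff by simp
    then have "card S = 0"
      using coeff_expansion_exponent_top[OF i(1)[unfolded kS] degree_p_le_degree_q order_refl, of c]
        coeff_expansion_exponent_top[OF bot degree_p_le_degree_q order_refl, of c] \<open>lead_coeff q \<noteq> 0\<close> by simp
    moreover have "finite S"
      using i(1) by (auto simp: kS expansion_index_def intro: finite_subset)
    ultimately have S: "S = {}" by simp
    have "drop_const (shift_poly p (of_nat k * c)) = drop_const (shift_poly p (of_nat n * c))"
      using i(2) unfolding kS S drop_const_eq_iff by (simp add: expansion_exponent_def)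
    from shift_poly_class_inj[OF this dp] have "k = n" using assms(1) by simp
    with S kS show ?thesis by simp
  qed
  then have "{i\<in>expansion_index n. drop_const (?E i) = drop_const (?E (n, {}))} = {(n, {})}"
    using bot by auto
  then have "drop_const (?E (n, {})) = 0" by (rule singleton_class_eq_0)
  then have "coeff (?E (n, {})) (degree q) = 0"
    using d coeff_drop_const[of "?E (n, {})" "degree q"] by (auto split: if_splits)
  then show False
    using coeff_expansion_exponent_top[OF bot degree_p_le_degree_q order_refl, of c] lead0 by simp
qed

text \<open>For linear \<open>q\<close> all shifts of \<open>p\<close> share one class. Its sum
  yields only that e^(n a c) = 1, with a the leading coefficient of \<open>q\<close>; the
  evaluations at two points sharpen this to e^(a c) = 1.\<close>

lemma linear_q_periodic:
  assumes "degree q = 1" "n \<ge> 1"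
  shows "exp (c * lead_coeff q) = 1"
proof -
  let ?E = "expansion_exponent c p q"
  define a where "a = lead_coeff q"
  define b0 where "b0 = poly p 0"
  have "a \<noteq> 0"
    using assms(1) unfolding a_def by (metis degree_0 leading_coeff_0_iff zero_neq_one)
  have q: "poly q z = poly q 0 + a * z" for z
    using assms(1) by (simp add: poly_altdef a_def poly_0_coeff_0)
  have p: "poly p z = b0 + of_nat n * a * z" for z
  proof -
    have "degree p \<le> 1" using degree_p_le_degree_q assms(1) by simp
    then have "p = [:coeff p 0, coeff p 1:]"
      by (intro poly_eqI) (auto simp: coeff_pCons coeff_eq_0 split: nat.split)
    moreover have "coeff p 1 = of_nat n * a" using coeff_p_degree_q assms(1) by (simp add: a_def)
    ultimately have "p = [:coeff p 0, of_nat n * a:]" by simp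
    then have "poly p z = coeff p 0 + z * (of_nat n * a)"
      by (metis add.right_neutral mult_zero_right poly_0 poly_pCons)
    then show ?thesis by (simp add: b0_def poly_0_coeff_0)
  qed
  have dp: "degree p \<le> 1" using degree_p_le_degree_q assms(1) by simp
  have bot: "(k, {}) \<in> expansion_index n" if "k \<le> n" for k using that by (simp add: expansion_index_def)
  have coeff_bot: "coeff (?E (k, {})) m = (if m = 0 then - (b0 + of_nat n * a * (of_nat k * c))
      else if m = 1 then - (of_nat n * a) else 0)" for k m
  proof -
    have "?E (k, {}) = [:- (b0 + of_nat n * a * (of_nat k * c)), - (of_nat n * a):]"
      by (intro poly_eqI_degree[of UNIV] poly_ext) (simp add: expansion_exponent_def poly_shift_poly p algebra_simps)
    then show ?thesis by (auto simp: coeff_pCons split: nat.split)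
  qed
  \<comment> \<open>The class of the pairs \<open>(k, {})\<close> contributes a multiple of \<open>(\<omega> - 1) ^ n\<close>.\<close>
  define \<omega> where "\<omega> = exp (- (of_nat n * a * c))"
  have "{i\<in>expansion_index n. drop_const (?E i) = drop_const (?E (n, {}))} = (\<lambda>k. (k, {})) ` {..n}" (is "?L = ?R")
  proof
    show "?R \<subseteq> ?L"
      using bot by (auto simp: drop_const_eq_iff coeff_bot)
    show "?L \<subseteq> ?R"
    proof
      fix i assume i: "i \<in> ?L"
      obtain k S where kS: "i = (k, S)" by (cases i)
      have "coeff (?E (k, S)) 1 = coeff (?E (n, {})) 1"
        using i unfolding kS drop_const_eq_iff by simp
      moreover have kSi: "(k, S) \<in> expansion_index n" using i kS by simp
      ultimately have "card S = 0"
        using coeff_expansion_exponent_top[OF kSi dp, of q c] coeff_expansion_exponent_top[OF bot[OF order_refl] dp, of q c]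
          assms(1) \<open>a \<noteq> 0\<close> by (simp add: a_def)
      moreover have "finite S" "k \<le> n"
        using kSi by (auto simp: expansion_index_def intro: finite_subset)
      ultimately show "i \<in> ?R" by (simp add: kS)
    qed
  qed
  moreover have "drop_const (?E (n, {})) \<noteq> 0"
  proof
    assume "drop_const (?E (n, {})) = 0"
    then have "coeff (?E (n, {})) 1 = 0" using coeff_drop_const[of "?E (n, {})" 1] by simp
    then show False using coeff_bot[of n 1] \<open>a \<noteq> 0\<close> assms(2) by simp
  qed
  ultimately have "(\<Sum>i\<in>(\<lambda>k. (k, {})) ` {..n}.
      (-1) ^ (n + fst i) * of_nat (n choose fst i) * exp (coeff (?E i) 0)) = 0"
    using expansion_class_sum[of "drop_const (?E (n, {}))"] by (simp only: if_False)
  then have "(\<Sum>k\<le>n. (-1) ^ (n + k) * of_nat (n choose k) * exp (coeff (?E (k, {})) 0)) = 0"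
    by (subst (asm) sum.reindex) (auto simp: inj_on_def)
  moreover have "(-1) ^ (n + k) * of_nat (n choose k) * exp (coeff (?E (k, {})) 0)
      = exp (- b0) * (of_nat (n choose k) * \<omega> ^ k * (-1) ^ (n - k))" if "k \<le> n" for k
  proof -
    have "exp (coeff (?E (k, {})) 0) = exp (- b0) * \<omega> ^ k"
      unfolding \<omega>_def coeff_bot by (simp add: exp_add[symmetric] exp_of_nat_mult[symmetric] algebra_simps)
    moreover have "(-1) ^ (n + k) = ((-1) ^ (n - k) :: complex)"
      using that by (simp add: minus_one_power_iff)
    ultimately show ?thesis by (simp add: mult_ac)
  qed
  ultimately have "exp (- b0) * (\<Sum>k\<le>n. of_nat (n choose k) * \<omega> ^ k * (-1) ^ (n - k)) = 0"
    by (simp add: sum_distrib_left)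
  then have "(\<omega> + (-1)) ^ n = 0"
    unfolding binomial_ring by simp
  then have \<omega>: "\<omega> = 1" by simp
  \<comment> \<open>At \<open>z0\<close> only the summand \<open>k = 0\<close> survives, at \<open>z0 - c\<close> only \<open>k = 0\<close> and \<open>k = 1\<close>.\<close>
  define z0 where "z0 = (\<i> * of_real pi - poly q 0) / a"
  have qz0: "poly q z0 = \<i> * of_real pi"
    using \<open>a \<noteq> 0\<close> q[of z0] by (simp add: z0_def)
  have exp_p: "exp (- poly p (z0 - c)) = exp (- poly p z0)"
  proof -
    have "exp (- poly p z0) = exp (- poly p (z0 - c)) * \<omega>"
      unfolding \<omega>_def p by (simp add: exp_add[symmetric] algebra_simps)
    then show ?thesis using \<omega> by simp
  qed
  have "exp_difference_sum c n p q z0 = (\<Sum>k\<in>{0}. (-1) ^ (n + k) * of_nat (n choose k) * exp (- poly p (z0 + of_nat k * c))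
      * (\<Prod>j<k. 1 + exp (poly q (z0 + of_nat j * c))))"
    unfolding exp_difference_sum_def
  proof (rule sum.mono_neutral_right)
    show "\<forall>k\<in>{..n} - {0}. (-1) ^ (n + k) * of_nat (n choose k) * exp (- poly p (z0 + of_nat k * c))
      * (\<Prod>j<k. 1 + exp (poly q (z0 + of_nat j * c))) = 0"
      by (auto intro!: bexI[of _ 0] simp: qz0)
  qed auto
  then have z0_eq: "(-1) ^ n * exp (- poly p z0) = 1" using exp_identity by simp
  have "exp_difference_sum c n p q (z0 - c) = (\<Sum>k\<in>{0, 1}. (-1) ^ (n + k) * of_nat (n choose k) * exp (- poly p (z0 - c + of_nat k * c))
      * (\<Prod>j<k. 1 + exp (poly q (z0 - c + of_nat j * c))))"
    unfolding exp_difference_sum_def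
  proof (rule sum.mono_neutral_right)
    show "\<forall>k\<in>{..n} - {0, 1}. (-1) ^ (n + k) * of_nat (n choose k) * exp (- poly p (z0 - c + of_nat k * c))
      * (\<Prod>j<k. 1 + exp (poly q (z0 - c + of_nat j * c))) = 0"
      by (auto intro!: bexI[of _ 1] simp: qz0)
  qed (use assms(2) in auto)
  then have "(-1) ^ n * exp (- poly p (z0 - c)) - (-1) ^ n * of_nat n * exp (- poly p z0) * (1 + exp (poly q (z0 - c))) = 1"
    using exp_identity by simp
  then have "((-1) ^ n * exp (- poly p z0)) * (1 - of_nat n * (1 + exp (poly q (z0 - c)))) = 1"
    unfolding exp_p by (simp add: algebra_simps)
  then have "1 + exp (poly q (z0 - c)) = 0"
    unfolding z0_eq using assms(2) by simp
  moreover have "poly q (z0 - c) = \<i> * of_real pi - c * a"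
    using qz0 q[of z0] q[of "z0 - c"] by (simp add: algebra_simps)
  ultimately have "1 - 1 / exp (c * a) = 0"
    by (simp add: exp_diff)
  then show ?thesis by (simp add: a_def)
qed

end

section \<open>Entire solutions of the difference equation\<close>

text \<open>One power more than the order \<open>m\<close> of \<open>g\<close> at \<open>z0\<close>
  is too many: after division by the \<open>m\<close>-th power of \<open>z - z0\<close>, a spare
  factor \<open>w\<close> tends to 0. The quotient of \<open>w z\<close> by \<open>z - z0\<close>
  tends to the derivative \<open>D\<close>, which may be 0, so multiple zeros of \<open>w\<close>
  are covered.\<close>

lemma zero_not_divisible_by_all_powers:
  assumes "g holomorphic_on UNIV" "\<exists>z. g z \<noteq> 0" "w holomorphic_on UNIV" "w z0 = 0"
  shows "\<exists>N. \<nexists>k. k holomorphic_on UNIV \<and> (\<forall>z. g z = w z ^ N * k z)"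
proof -
  obtain h m where h: "h holomorphic_on UNIV" "h z0 \<noteq> 0" "\<And>z. g z = (z - z0) ^ m * h z"
    using entire_factor_zero[OF assms(1,2), where a = z0] by blast
  have False if k: "k holomorphic_on UNIV" "\<forall>z. g z = w z ^ Suc m * k z" for k
  proof -
    have isCont: "v \<midarrow>z0\<rightarrow> v z0" if "v holomorphic_on UNIV" for v
      using holomorphic_on_imp_continuous_on[OF that] by (simp add: continuous_on_eq_continuous_at isContD)
    obtain D where "(w has_field_derivative D) (at z0)"
      using assms(3) by (auto simp: holomorphic_on_def field_differentiable_def)
    then have "(\<lambda>z. w z / (z - z0)) \<midarrow>z0\<rightarrow> D"
      using assms(4) by (simp add: has_field_derivative_iff)
    then have lim: "(\<lambda>z. (w z / (z - z0)) ^ m * (w z * k z)) \<midarrow>z0\<rightarrow> D ^ m * (w z0 * k z0)"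
      by (intro tendsto_intros isCont assms(3) k(1))
    have "(w z / (z - z0)) ^ m * (w z * k z) = h z" if "z \<noteq> z0" for z
    proof -
      have "(z - z0) ^ m * h z = w z ^ m * (w z * k z)"
        using k(2) h(3)[of z] by (simp add: mult_ac)
      then show ?thesis
        using that by (simp add: power_divide field_simps)
    qed
    then have "h \<midarrow>z0\<rightarrow> 0"
      using lim assms(4) LIM_equal[of z0 "\<lambda>z. (w z / (z - z0)) ^ m * (w z * k z)" h] by simp
    then show False
      using isCont[OF h(1)] h(2) LIM_unique by blast
  qed
  then show ?thesis by blast
qed

text \<open>Cancellation is possible only where \<open>g\<close> does not vanish; the identity
  theorem extends the equality from this nonempty open set.\<close>

lemma holomorphic_mult_cancel:
  assumes "u holomorphic_on UNIV" "g holomorphic_on UNIV" "\<exists>z. g z \<noteq> 0" "\<And>z. u z * g z = v * g z"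
  shows "u z = v"
proof (rule analytic_continuation_open[of "{z. g z \<noteq> 0}" UNIV u "\<lambda>_. v"])
  have "continuous_on UNIV g" using assms(2) by (rule holomorphic_on_imp_continuous_on)
  then show "open {z. g z \<noteq> 0}"
    by (intro open_Collect_neq continuous_on_const)
qed (use assms in \<open>auto intro: holomorphic_intros\<close>)

lemma shift_funpow_factor:
  assumes "\<And>z. g (z + c) = (1 + exp (poly q z)) * g z"
  shows "g (z + of_nat k * c) = (\<Prod>j<k. 1 + exp (poly q (z + of_nat j * c))) * g z"
proof (induction k)
  case (Suc k)
  have "g (z + of_nat (Suc k) * c) = g ((z + of_nat k * c) + c)"
    by (simp add: algebra_simps)
  also have "\<dots> = (1 + exp (poly q (z + of_nat k * c))) * ((\<Prod>j<k. 1 + exp (poly q (z + of_nat j * c))) * g z)"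
    unfolding assms Suc.IH ..
  finally show ?case by (simp add: mult_ac)
qed simp

text \<open>If \<open>w = 1 + e^q\<close> has period \<open>c\<close>, iterating the equation
  backwards writes \<open>g\<close> as \<open>w^N\<close> times a translate of \<open>g\<close>. The
  translate is entire, and \<open>w\<close> has a zero because \<open>q\<close> is linear.\<close>

lemma shift_factor_not_periodic:
  assumes "g holomorphic_on UNIV" "\<exists>z. g z \<noteq> 0" "\<And>z. g (z + c) = (1 + exp (poly q z)) * g z"
    and "degree q = 1"
  shows "exp (c * lead_coeff q) \<noteq> 1"
proof
  assume per: "exp (c * lead_coeff q) = 1"
  define w where "w = (\<lambda>z. 1 + exp (poly q z))"
  have q: "poly q z = coeff q 0 + lead_coeff q * z" for z
    using assms(4) by (simp add: poly_altdef)
  have "lead_coeff q \<noteq> 0"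
    using assms(4) by (metis degree_0 leading_coeff_0_iff zero_neq_one)
  define z0 where "z0 = (\<i> * of_real pi - coeff q 0) / lead_coeff q"
  have w0: "w z0 = 0"
    using \<open>lead_coeff q \<noteq> 0\<close> by (simp add: w_def q z0_def)
  have w: "w holomorphic_on UNIV"
    unfolding w_def by (intro holomorphic_intros)
  have wp: "w (z + of_nat j * c) = w z" for z j
  proof -
    have "exp (poly q (z + of_nat j * c)) = exp (poly q z) * exp (c * lead_coeff q) ^ j"
      unfolding q by (simp add: exp_add[symmetric] exp_of_nat_mult[symmetric] algebra_simps)
    then show ?thesis using per by (simp add: w_def)
  qed
  have "g z = w z ^ N * g (z - of_nat N * c)" for z N
  proof -
    have "g z = (\<Prod>j<N. w (z - of_nat N * c + of_nat j * c)) * g (z - of_nat N * c)"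
      using shift_funpow_factor[OF assms(3), of "z - of_nat N * c" N] by (simp add: w_def)
    also have "(\<Prod>j<N. w (z - of_nat N * c + of_nat j * c)) = w z ^ N"
      using wp[of "z - of_nat N * c" N] by (simp add: wp)
    finally show ?thesis .
  qed
  moreover have "(\<lambda>z. g (z - of_nat N * c)) holomorphic_on UNIV" for N
    by (rule holomorphic_on_compose_gen[unfolded o_def, OF _ assms(1)]) (auto intro!: holomorphic_intros)
  ultimately show False
    using zero_not_divisible_by_all_powers[OF assms(1,2) w w0] by blast
qed

theorem theorem1p3:
  fixes c :: complex and n :: nat and f :: "complex \<Rightarrow> complex"
  assumes "n \<ge> 1"
    and "f holomorphic_on UNIV"
    and "\<not> f constant_on UNIV"
    and "finite_order f"
    and "\<exists>z. (difference c ^^ n) f z \<noteq> 0"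
    and "share_zero_CM {f, (difference c ^^ n) f, (difference c ^^ (n + 1)) f}"
  shows "\<exists>C. C \<noteq> 0 \<and> (\<forall>z. difference c f z = C * f z)"
proof -
  define g where "g = (difference c ^^ n) f"
  have g_nz: "\<exists>z. g z \<noteq> 0" using assms(5) by (simp add: g_def)
  have Dg: "(difference c ^^ (n + 1)) f = difference c g" by (simp add: g_def)
  have hol: "g holomorphic_on UNIV" "difference c g holomorphic_on UNIV"
    unfolding g_def using assms(2) by (auto intro: holomorphic_difference holomorphic_difference_funpow)
  have growth: "exp_poly_growth f" "exp_poly_growth g" "exp_poly_growth (difference c g)"
    using finite_order_imp_exp_poly_growth[OF assms(2,4)] exp_poly_growth_difference_funpow[of f n c]
      exp_poly_growth_difference_funpow[of f "Suc n" c] by (simp_all add: g_def)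
  have share: "(u z = 0 \<longleftrightarrow> v z = 0) \<and> (u z = 0 \<longrightarrow> zorder u z = zorder v z)"
    if "u \<in> {f, g, difference c g}" "v \<in> {f, g, difference c g}" for u v z
    using assms(6) that unfolding Dg g_def[symmetric] share_zero_CM_def by blast
  have f_nz: "\<exists>z. f z \<noteq> 0" using g_nz share[of f g] by blast
  have quotient: "\<exists>p. \<forall>z. v z = exp (poly p z) * u z"
    if uv: "u \<in> {f, g, difference c g}" "v \<in> {f, g, difference c g}" for u v
  proof -
    have u: "u holomorphic_on UNIV" "exp_poly_growth u" and v: "v holomorphic_on UNIV" "exp_poly_growth v"
      using uv hol assms(2) growth by auto
    have u_nz: "\<exists>z. u z \<noteq> 0" using f_nz share[of f u] uv by blast
    have v_nz: "\<exists>z. v z \<noteq> 0" using f_nz share[of f v] uv by blast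
    \<comment> \<open>Sharing 0 CM compares orders at zeros only; at all other points both orders
      are 0.\<close>
    have "zorder u z = zorder v z" for z
    proof (cases "u z = 0")
      case False
      have "zorder k z = 0" if "k holomorphic_on UNIV" "k z \<noteq> 0" for k
        using that by (intro zorder_eq_0I) (auto simp: analytic_on_open holomorphic_on_imp_analytic_at)
      with False show ?thesis using share[OF uv, of z] u v by simp
    qed (use share[OF uv] in blast)
    then obtain h where h: "h holomorphic_on UNIV" "\<And>z. h z \<noteq> 0" "\<And>z. v z = h z * u z"
      using holomorphic_zorder_factorization[OF v(1) open_UNIV connected_UNIV u(1)] share[OF uv] by (metis UNIV_I)
    have "\<exists>p. \<forall>z. h z = exp (poly p z)"
      by (rule exp_quotient_poly[OF u(1) h(1,2,3) u(2) v(2) u_nz])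
    with h(3) show ?thesis by metis
  qed
  obtain p where p: "\<And>z. g z = exp (poly p z) * f z" using quotient[of f g] by blast
  obtain q where q: "\<And>z. difference c g z = exp (poly q z) * g z" using quotient[of g "difference c g"] by blast
  have gc: "g (z + c) = (1 + exp (poly q z)) * g z" for z
    using q[of z] by (simp add: difference_def algebra_simps)
  have f_eq: "f z = exp (- poly p z) * g z" for z
    by (simp add: p exp_minus)
  have c: "c \<noteq> 0"
  proof
    assume "c = 0"
    then have "difference c g z = 0" for z by (simp add: difference_def)
    then show False using q g_nz by simp
  qed
  have exp_identity: "exp_difference_sum c n p q z = 1" for z
  proof (rule holomorphic_mult_cancel[where u = "exp_difference_sum c n p q", OF _ hol(1) g_nz])
    show "exp_difference_sum c n p q holomorphic_on UNIV"
      unfolding exp_difference_sum_def[abs_def] by (intro holomorphic_intros)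
    fix z
    have "exp_difference_sum c n p q z * g z = (\<Sum>k\<le>n. (-1) ^ (n + k) * of_nat (n choose k) * f (z + of_nat k * c))"
      unfolding exp_difference_sum_def f_eq shift_funpow_factor[OF gc] by (simp add: sum_distrib_left sum_distrib_right mult_ac)
    also have "\<dots> = g z" by (simp only: g_def difference_funpow)
    finally show "exp_difference_sum c n p q z * g z = 1 * g z" by simp
  qed
  have "degree q \<le> 1" by (rule degree_q_le_1[OF exp_identity c assms(1)])
  moreover have "degree q \<noteq> 1"
    using linear_q_periodic[OF exp_identity _ assms(1)] shift_factor_not_periodic[OF hol(1) g_nz gc] by blast
  ultimately have "degree q = 0" by simp
  moreover have "degree p = 0" using degree_p_le_degree_q[OF exp_identity] \<open>degree q = 0\<close> by simp
  ultimately obtain a b where ab: "p = [:a:]" "q = [:b:]" by (metis degree_eq_zeroE)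
  \<comment> \<open>For constant \<open>p\<close>, \<open>f\<close> is a constant multiple of
    \<open>g\<close> and inherits its difference equation.\<close>
  have "difference c f z = exp b * f z" for z
    using q[of z] by (simp add: difference_def f_eq ab right_diff_distrib[symmetric])
  then show ?thesis by (intro exI[of _ "exp b"]) simp
qed

end
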